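(* Every element of $\tilde{\mathcal{C}}$ is equal to $\varphi_{\omega}$ for exactly one $\omega \in \Omega^*$. Moreover, the map $\Omega^* \to \tilde{\mathcal{C}}$, $\omega \mapsto \varphi_\omega$, is a homeomorphism of $\Omega^*$ onto $\tilde{\mathcal{C}}$ (the latter with the relative weak* topology of $(l^\infty)^*$).
   Context: $l^\infty$ is the Banach space of real-valued bounded functions on $\mathbb{N}=\{1,2,\dots\}$. For an ultrafilter $\mathcal{U}$ on a set $X$ and bounded $g: X\to\mathbb{R}$, $\mathcal{U}\text{-}\lim_x g(x)$ is the unique $\alpha\in\mathbb{R}$ with $\{x : |g(x)-\alpha|<\varepsilon\}\in\mathcal{U}$ for all $\varepsilon>0$. $\tilde{\mathcal{C}}$ is the set of linear functionals on $l^\infty$ of the form $\varphi^{\mathcal{U}}(f) = \mathcal{U}\text{-}\lim_n \frac{1}{n}\sum_{i=1}^n f(i)$ with $\mathcal{U}$ a free ultrafilter on $\mathbb{N}$. Let $\beta\mathbb{N}$ be the Stone–Čech compactification of $\mathbb{N}$ (identified with the space of ultrafilters on $\mathbb{N}$) and $\mathbb{N}^* = \beta\mathbb{N}\setminus\mathbb{N}$ (free ultrafilters). Let $\tau:\beta\mathbb{N}\to\beta\mathbb{N}$ be the continuous extension of $n\mapsto n+1$; on ultrafilters, $\tau\eta = \{S\subseteq\mathbb{N} : \{n : n+1\in S\}\in\eta\}$; its restriction to $\mathbb{N}^*$ is a homeomorphism of $\mathbb{N}^*$. Let $\Omega$ be the quotient of $\beta\mathbb{N}\times[0,1]$ obtained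 by identifying $(\eta,1)$ with $(\tau\eta,0)$ for all $\eta\in\beta\mathbb{N}$, and $\Omega^*\subseteq\Omega$ the closed subspace of classes of points $(\eta,t)$ with $\eta\in\mathbb{N}^*$. For $\omega=(\eta,t)\in\Omega^*$ put $\theta=2^t$ and define $\varphi_\omega(f) = \eta\text{-}\lim_n \frac{1}{\theta\cdot 2^n}\sum_{i=1}^{[\theta\cdot 2^n]} f(i)$ for $f\in l^\infty$, where $[x]$ is the integer part of $x$ (this is independent of the representative of $\omega$). *)

theory Defs
  imports "HOL-Analysis.Analysis"
begin

section \<open>The index set and the space of bounded functions\<close>

typedef posnat = "{n::nat. 1 \<le> n}"
  morphisms nat_of_posnat posnat_of_nat
  by blast

setup_lifting type_definition_posnat

lift_definition posnat_Suc :: "posnat \<Rightarrow> posnat" is Suc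
  by simp

text \<open>With the discrete topology on the index set every function on it is continuous, so that
  the library's bounded continuous functions are exactly the bounded functions, with the
  supremum norm.\<close>

instantiation posnat :: discrete_topology
begin

definition open_posnat :: "posnat set \<Rightarrow> bool" where
  "open_posnat S \<longleftrightarrow> True"

instance
  by standard (simp_all add: open_posnat_def)

end

type_synonym linf = "posnat \<Rightarrow>\<^sub>C real"

text \<open>For real-valued functionals, the strong operator topology is the topology of pointwise
  convergence on the domain, i.e. the weak* topology of the dual.\<close>

abbreviation weak_star :: "(linf \<Rightarrow>\<^sub>L real) topology" where
  "weak_star \<equiv> strong_operator_topology"


section \<open>Ultrafilters\<close>

text \<open>A set \<open>S\<close> belongs to the filter \<open>F\<close> iff \<open>eventually (\<lambda>x. x \<in> S) F\<close>, and the limit of \<open>g\<close>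
  along \<open>F\<close> is the library's \<open>Lim F g\<close>.\<close>

definition ultrafilter :: "'a filter \<Rightarrow> bool" where
  "ultrafilter F \<longleftrightarrow> F \<noteq> bot \<and> (\<forall>P. eventually P F \<or> eventually (\<lambda>x. \<not> P x) F)"

lemma ultrafilter_principal: "ultrafilter (principal {x})"
  by (auto simp: ultrafilter_def eventually_principal principal_eq_bot_iff)

lemma ultrafilter_filtermap: "ultrafilter F \<Longrightarrow> ultrafilter (filtermap h F)"
  by (auto simp: ultrafilter_def eventually_filtermap filtermap_bot_iff)

lemma ultrafilter_tendsto_Lim:
  fixes g :: "'a \<Rightarrow> real"
  assumes "ultrafilter F" and "\<And>x. \<bar>g x\<bar> \<le> B"
  shows "(g \<longlongrightarrow> Lim F g) F"
proof -
  let ?G = "filtermap g F"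
  have G: "ultrafilter ?G"
    using assms(1) by (rule ultrafilter_filtermap)
  have "eventually (\<lambda>y. y \<in> {-B..B}) ?G"
    using assms(2) by (auto simp: eventually_filtermap abs_le_iff minus_le_iff intro!: always_eventually)
  moreover have "?G \<noteq> bot"
    using G by (simp add: ultrafilter_def)
  ultimately obtain l where l: "inf (nhds l) ?G \<noteq> bot"
    using compact_Icc[of "-B" B] unfolding compact_filter by blast
  have "?G \<le> nhds l"
  proof (rule filter_leI)
    fix P assume P: "eventually P (nhds l)"
    have "\<not> eventually (\<lambda>x. \<not> P x) ?G"
    proof
      assume "eventually (\<lambda>x. \<not> P x) ?G"
      then have "eventually (\<lambda>x. False) (inf (nhds l) ?G)"
        unfolding eventually_inf using P by blast
      with l show False
        by (simp add: trivial_limit_def)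
    qed
    with G show "eventually P ?G"
      unfolding ultrafilter_def by blast
  qed
  then have "(g \<longlongrightarrow> l) F"
    by (simp add: filterlim_def)
  moreover have "F \<noteq> bot"
    using assms(1) by (simp add: ultrafilter_def)
  ultimately show ?thesis
    using tendsto_Lim by blast
qed

lemma Lim_eq_ultrafilter_limit:
  fixes g :: "'a \<Rightarrow> real"
  shows "Lim F g = (THE \<alpha>. \<forall>\<epsilon>>0. eventually (\<lambda>x. x \<in> {x. \<bar>g x - \<alpha>\<bar> < \<epsilon>}) F)"
  by (simp add: t2_space_class.Lim_def tendsto_iff dist_real_def)

lemma bounded_linear_Lim:
  fixes A :: "'v::real_normed_vector \<Rightarrow> 'a \<Rightarrow> real"
  assumes U: "ultrafilter F"
    and add: "\<And>f g x. A (f + g) x = A f x + A g x"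
    and scale: "\<And>c f x. A (c *\<^sub>R f) x = c * A f x"
    and bound: "\<And>f x. \<bar>A f x\<bar> \<le> norm f"
  shows "bounded_linear (\<lambda>f. Lim F (A f))"
proof -
  have F: "F \<noteq> bot"
    using U by (simp add: ultrafilter_def)
  have lim: "(A f \<longlongrightarrow> Lim F (A f)) F" for f
    using U bound by (rule ultrafilter_tendsto_Lim)
  show ?thesis
  proof (rule bounded_linear_intro[where K = 1])
    fix f g
    have "(A (f + g) \<longlongrightarrow> Lim F (A f) + Lim F (A g)) F"
      using tendsto_add[OF lim lim] by (simp add: add[abs_def])
    then show "Lim F (A (f + g)) = Lim F (A f) + Lim F (A g)"
      by (rule tendsto_Lim[OF F])
  next
    fix c f
    have "(A (c *\<^sub>R f) \<longlongrightarrow> c * Lim F (A f)) F"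
      using tendsto_mult_left[OF lim] by (simp add: scale[abs_def])
    then show "Lim F (A (c *\<^sub>R f)) = c *\<^sub>R Lim F (A f)"
      by (simp add: tendsto_Lim[OF F])
  next
    fix f
    have "\<bar>Lim F (A f)\<bar> \<le> norm f"
      by (rule tendsto_upperbound[OF tendsto_rabs[OF lim] _ F]) (simp add: bound)
    then show "norm (Lim F (A f)) \<le> norm f * 1"
      by simp
  qed
qed


section \<open>The Stone-Cech compactification\<close>

typedef betaN = "{F :: posnat filter. ultrafilter F}"
  using ultrafilter_principal[of undefined] by auto

setup_lifting type_definition_betaN

instantiation betaN :: topological_space
begin

definition open_betaN :: "betaN set \<Rightarrow> bool" where
  "open_betaN = generate_topology (range (\<lambda>S. {\<eta>. eventually (\<lambda>n. n \<in> S) (Rep_betaN \<eta>)}))"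

instance
  by standard (auto simp: open_betaN_def intro: generate_topology.intros)

end

definition betaN_of :: "posnat \<Rightarrow> betaN" where
  "betaN_of n = Abs_betaN (principal {n})"

lemma Rep_betaN_of: "Rep_betaN (betaN_of n) = principal {n}"
  by (simp add: betaN_of_def Abs_betaN_inverse ultrafilter_principal)

definition Nstar :: "betaN set" where
  "Nstar = UNIV - range betaN_of"

lift_definition tau :: "betaN \<Rightarrow> betaN" is "filtermap posnat_Suc"
  by (rule ultrafilter_filtermap)

lemma eventually_tau:
  "eventually (\<lambda>n. n \<in> S) (Rep_betaN (tau \<eta>)) \<longleftrightarrow>
     eventually (\<lambda>n. n \<in> {n. posnat_Suc n \<in> S}) (Rep_betaN \<eta>)"
  by (simp add: tau.rep_eq eventually_filtermap)


section \<open>Density functionals\<close>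

lemma bounded_linear_Lim_average:
  fixes F :: "posnat filter" and c :: "posnat \<Rightarrow> real" and m :: "posnat \<Rightarrow> nat"
  assumes "ultrafilter F" and c: "\<And>n. 0 < c n" and m: "\<And>n. real (m n) \<le> c n"
  shows "bounded_linear (\<lambda>f::linf.
    Lim F (\<lambda>n. 1 / c n * (\<Sum>i = 1..m n. f (posnat_of_nat i))))"
proof (rule bounded_linear_Lim[OF assms(1)])
  fix f :: linf and n
  have "\<bar>\<Sum>i = 1..m n. f (posnat_of_nat i)\<bar> \<le> (\<Sum>i = 1..m n. \<bar>f (posnat_of_nat i)\<bar>)"
    by (rule sum_abs)
  also have "\<dots> \<le> (\<Sum>i = 1..m n. norm f)"
    by (rule sum_mono) (metis norm_bounded real_norm_def)
  also have "\<dots> \<le> c n * norm f"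
    using m[of n] by (simp add: mult_right_mono)
  finally show "\<bar>1 / c n * (\<Sum>i = 1..m n. f (posnat_of_nat i))\<bar> \<le> norm f"
    using c[of n] by (simp add: abs_mult field_simps)
qed (simp_all add: sum.distrib distrib_left sum_distrib_left ac_simps)

definition phi_ultra :: "betaN \<Rightarrow> linf \<Rightarrow>\<^sub>L real" where
  "phi_ultra U = Blinfun (\<lambda>f::linf. Lim (Rep_betaN U) (\<lambda>n. 1 / real (nat_of_posnat n) *
      (\<Sum>i = 1..nat_of_posnat n. f (posnat_of_nat i))))"

lemma phi_ultra_apply:
  "blinfun_apply (phi_ultra U) f = Lim (Rep_betaN U) (\<lambda>n. 1 / real (nat_of_posnat n) *
      (\<Sum>i = 1..nat_of_posnat n. f (posnat_of_nat i)))"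
proof -
  have "0 < real (nat_of_posnat n)" for n
    using nat_of_posnat[of n] by simp
  then show ?thesis
    unfolding phi_ultra_def using Rep_betaN[of U]
    by (subst bounded_linear_Blinfun_apply, intro bounded_linear_Lim_average) auto
qed

definition C_tilde :: "(linf \<Rightarrow>\<^sub>L real) set" where
  "C_tilde = phi_ultra ` Nstar"

definition phi_point :: "betaN \<Rightarrow> real \<Rightarrow> linf \<Rightarrow>\<^sub>L real" where
  "phi_point \<eta> t = (let \<theta> = 2 powr t in
     Blinfun (\<lambda>f::linf. Lim (Rep_betaN \<eta>) (\<lambda>n. 1 / (\<theta> * 2 ^ nat_of_posnat n) *
       (\<Sum>i = 1..nat \<lfloor>\<theta> * 2 ^ nat_of_posnat n\<rfloor>. f (posnat_of_nat i)))))"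

lemma phi_point_apply:
  "blinfun_apply (phi_point \<eta> t) f =
     Lim (Rep_betaN \<eta>) (\<lambda>n. 1 / (2 powr t * 2 ^ nat_of_posnat n) *
       (\<Sum>i = 1..nat \<lfloor>2 powr t * 2 ^ nat_of_posnat n\<rfloor>. f (posnat_of_nat i)))"
  unfolding phi_point_def Let_def using Rep_betaN[of \<eta>]
  by (subst bounded_linear_Blinfun_apply, intro bounded_linear_Lim_average) auto


section \<open>The quotient space\<close>

definition quotient_topology :: "'a topology \<Rightarrow> ('a \<times> 'a) set \<Rightarrow> 'a set topology" where
  "quotient_topology X r =
     topology (\<lambda>U. U \<subseteq> topspace X // r \<and> openin X {x \<in> topspace X. r `` {x} \<in> U})"

lemma openin_quotient_topology:
  "openin (quotient_topology X r) U \<longleftrightarrow>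
     U \<subseteq> topspace X // r \<and> openin X {x \<in> topspace X. r `` {x} \<in> U}"
proof -
  have "istopology (\<lambda>U. U \<subseteq> topspace X // r \<and> openin X {x \<in> topspace X. r `` {x} \<in> U})"
    unfolding istopology_def
  proof (intro conjI allI impI)
    fix S T
    assume "S \<subseteq> topspace X // r \<and> openin X {x \<in> topspace X. r `` {x} \<in> S}"
      and "T \<subseteq> topspace X // r \<and> openin X {x \<in> topspace X. r `` {x} \<in> T}"
    moreover have "{x \<in> topspace X. r `` {x} \<in> S \<inter> T} =
        {x \<in> topspace X. r `` {x} \<in> S} \<inter> {x \<in> topspace X. r `` {x} \<in> T}"
      by blast
    ultimately show "S \<inter> T \<subseteq> topspace X // r"
      and "openin X {x \<in> topspace X. r `` {x} \<in> S \<inter> T}"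
      by auto
  next
    fix K
    assume K: "\<forall>S\<in>K. S \<subseteq> topspace X // r \<and> openin X {x \<in> topspace X. r `` {x} \<in> S}"
    then show "\<Union>K \<subseteq> topspace X // r"
      by blast
    have "{x \<in> topspace X. r `` {x} \<in> \<Union>K} = (\<Union>S\<in>K. {x \<in> topspace X. r `` {x} \<in> S})"
      by blast
    with K show "openin X {x \<in> topspace X. r `` {x} \<in> \<Union>K}"
      by auto
  qed
  then show ?thesis
    by (simp add: quotient_topology_def)
qed

lemma quotient_map_quotient_topology:
  "quotient_map X (quotient_topology X r) (\<lambda>x. r `` {x})"
proof -
  have "{x \<in> topspace X. r `` {x} \<in> topspace X // r} = topspace X"
    by (auto simp: quotient_def)
  then have "topspace X // r \<subseteq> topspace (quotient_topology X r)"
    by (intro openin_subset) (simp add: openin_quotient_topology)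
  moreover have "topspace (quotient_topology X r) \<subseteq> topspace X // r"
    using openin_topspace openin_quotient_topology by blast
  ultimately have "topspace (quotient_topology X r) = topspace X // r"
    by blast
  then show ?thesis
    unfolding quotient_map_def by (auto simp: openin_quotient_topology quotient_def)
qed

definition cylinder :: "(betaN \<times> real) topology" where
  "cylinder = top_of_set (UNIV \<times> {0..1})"

inductive glue :: "betaN \<times> real \<Rightarrow> betaN \<times> real \<Rightarrow> bool" where
  "glue (\<eta>, 1) (tau \<eta>, 0)"

text \<open>The glued points all lie in the cylinder; the restriction only removes the trivial
  classes of points outside it.\<close>

definition Omega_rel :: "((betaN \<times> real) \<times> (betaN \<times> real)) set" where
  "Omega_rel = {(p, q). p \<in> topspace cylinder \<and> q \<in> topspace cylinder \<and> equivclp glue p q}"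

definition Omega_topology :: "(betaN \<times> real) set topology" where
  "Omega_topology = quotient_topology cylinder Omega_rel"

definition Omega_star :: "(betaN \<times> real) set set" where
  "Omega_star = {Omega_rel `` {(\<eta>, t)} | \<eta> t. \<eta> \<in> Nstar \<and> t \<in> {0..1}}"

text \<open>The functional of a class is the common value of \<open>phi_point\<close> on its representatives;
  see \<open>phi_class\<close> below.\<close>

definition phi :: "(betaN \<times> real) set \<Rightarrow> linf \<Rightarrow>\<^sub>L real" where
  "phi \<omega> = the_elem ((\<lambda>(\<eta>, t). phi_point \<eta> t) ` \<omega>)"

lemma phi_point_glue: "phi_point (tau \<eta>) 0 = phi_point \<eta> 1"
proof -
  have Lim_filtermap: "Lim (filtermap h F) g = Lim F (\<lambda>x. g (h x))"
    for h :: "posnat \<Rightarrow> posnat" and F and g :: "posnat \<Rightarrow> real"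
    by (simp add: t2_space_class.Lim_def filterlim_filtermap)
  have "\<lfloor>2 * 2 ^ m :: real\<rfloor> = 2 * 2 ^ m" for m
    using floor_of_int[of "2 * 2 ^ m"] by simp
  then show ?thesis
    by (intro blinfun_eqI)
      (simp add: phi_point_apply tau.rep_eq Lim_filtermap posnat_Suc.rep_eq)
qed

lemma phi_class:
  assumes "t \<in> {0..1}"
  shows "phi (Omega_rel `` {(\<eta>, t)}) = phi_point \<eta> t"
proof -
  let ?f = "\<lambda>(\<eta>, t). phi_point \<eta> t"
  have step: "?f p = ?f q" if "symclp glue p q" for p q
    using that by (auto simp: symclp_def phi_point_glue elim!: glue.cases)
  have eq: "?f p = ?f q" if "equivclp glue p q" for p q
    using that unfolding equivclp_def by induction (auto dest: step)
  have "?f ` (Omega_rel `` {(\<eta>, t)}) = {phi_point \<eta> t}"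
  proof
    show "?f ` (Omega_rel `` {(\<eta>, t)}) \<subseteq> {phi_point \<eta> t}"
      using eq by (fastforce simp: Omega_rel_def)
    have "(\<eta>, t) \<in> Omega_rel `` {(\<eta>, t)}"
      using assms by (simp add: Omega_rel_def cylinder_def equivclp_def)
    then show "{phi_point \<eta> t} \<subseteq> ?f ` (Omega_rel `` {(\<eta>, t)})"
      by force
  qed
  then show ?thesis
    by (simp add: phi_def)
qed

end

(* Writing A_f(x) for the average of f over the integers in [1, x], two scales x(n), y(n) tending to
infinity along an ultrafilter with ratio tending to 1 yield the same limits of A_f. Hence every free
ultrafilter U gives a functional phi_omega: split m = 2^(k + s) with k the integer part of
log2 m, let t be the limit of s along U and push U forward along k. Conversely, phi_omega is the
functional of the image of eta under n |-> [theta 2^n].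

For injectivity, a bounded Lipschitz function u has a companion f in l^oo whose average over
{1..N} is exactly u(log2 N), so that phi_omega(f) is the limit of u(n + t) along eta. Truncated
distances to the sets {n + t | n in S} recover first t in [0, 1) and then eta.

Finally, phi is continuous on the compact space Omega^* (on N^* x [0, 1] it is Lipschitz in 2^t
uniformly in eta, and continuous in eta for fixed t), and the weak* topology is Hausdorff. *)
theory Submission
  imports Defs "HOL-Real_Asymp.Real_Asymp"
begin

section \<open>Free ultrafilters and compactness\<close>

text \<open>Ultrafilters are minimal among proper filters: if \<open>F\<close> lacks
  \<open>P\<close>, it contains the negation of \<open>P\<close>, and so does the finer filter
  \<open>G\<close>, which then cannot contain \<open>P\<close> as well.\<close>

lemma ultrafilter_le_eq:
  assumes "ultrafilter F" "G \<le> F" "G \<noteq> bot"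
  shows "G = F"
proof (rule antisym[OF assms(2)], rule filter_leI)
  fix P assume P: "eventually P G"
  show "eventually P F"
  proof (rule ccontr)
    assume "\<not> eventually P F"
    then have "eventually (\<lambda>x. \<not> P x) G"
      using assms(1,2) by (auto simp: ultrafilter_def le_filter_def)
    with P have "eventually (\<lambda>x. False) G"
      by eventually_elim simp
    with assms(3) show False
      by (simp add: trivial_limit_def)
  qed
qed

text \<open>Zorn's lemma is applied to the reversed order, since finer filters are smaller.\<close>

lemma ex_ultrafilter_le:
  assumes "G \<noteq> bot"
  shows "\<exists>F. ultrafilter F \<and> F \<le> G"
proof -
  let ?A = "{F. F \<noteq> bot \<and> F \<le> G}"
  have "\<exists>m\<in>?A. \<forall>a\<in>?A. a \<le> m \<longrightarrow> a = m"
  proof (rule predicate_Zorn)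
    show "partial_order_on ?A (relation_of (\<lambda>x y. y \<le> x) ?A)"
      by (rule partial_order_on_relation_ofI) auto
  next
    fix C assume C: "C \<in> Chains (relation_of (\<lambda>x y. y \<le> x) ?A)"
    then have CA: "C \<subseteq> ?A" and chain: "\<And>a b. a \<in> C \<Longrightarrow> b \<in> C \<Longrightarrow> a \<le> b \<or> b \<le> a"
      by (fastforce simp: Chains_def relation_of_def)+
    show "\<exists>u\<in>?A. \<forall>a\<in>C. u \<le> a"
    proof (cases "C = {}")
      case True
      with assms show ?thesis by auto
    next
      case False
      \<comment> \<open>A chain is a filter base, so what holds eventually for its infimum already
        does so for a member; hence the infimum is proper.\<close>
      have "eventually P (Inf C) \<longleftrightarrow> (\<exists>b\<in>C. eventually P b)" for P
      proof (rule eventually_Inf_base[OF False])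
        fix F H assume "F \<in> C" "H \<in> C"
        with chain[of F H] show "\<exists>x\<in>C. x \<le> inf F H"
          by (auto intro: bexI[of _ F] bexI[of _ H])
      qed
      then have "Inf C \<noteq> bot"
        using CA by (auto simp: trivial_limit_def)
      moreover have "Inf C \<le> G"
        using False CA by (auto intro: Inf_lower2)
      ultimately show ?thesis
        by (auto intro: Inf_lower)
    qed
  qed
  then obtain F where F: "F \<noteq> bot" "F \<le> G"
    and max: "\<And>H. H \<noteq> bot \<Longrightarrow> H \<le> F \<Longrightarrow> H = F"
    by (metis (mono_tags, lifting) mem_Collect_eq order_trans)
  \<comment> \<open>Adjoining the complement of \<open>P\<close> to \<open>F\<close> gives either
    the improper filter, so that \<open>P\<close> belongs to \<open>F\<close>, or, by minimality,
    \<open>F\<close> itself.\<close>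
  have "eventually P F \<or> eventually (\<lambda>x. \<not> P x) F" for P
  proof (cases "inf F (principal {x. \<not> P x}) = bot")
    case True
    then show ?thesis
      by (simp add: trivial_limit_def eventually_inf_principal)
  next
    case False
    then have "inf F (principal {x. \<not> P x}) = F"
      by (intro max) auto
    moreover have "eventually (\<lambda>x. \<not> P x) (inf F (principal {x. \<not> P x}))"
      by (simp add: eventually_inf_principal)
    ultimately show ?thesis
      by simp
  qed
  with F show ?thesis
    by (auto simp: ultrafilter_def)
qed

section \<open>Compactness of the space of ultrafilters\<close>

lemma ultrafilter_Rep_betaN [simp]: "ultrafilter (Rep_betaN \<eta>)"
  using Rep_betaN by simp

lemma Rep_betaN_neq_bot [simp]: "Rep_betaN \<eta> \<noteq> bot"
  using ultrafilter_Rep_betaN[of \<eta>] unfolding ultrafilter_def by blast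

lemma open_betaN_basic: "open {\<eta>. eventually (\<lambda>n. n \<in> S) (Rep_betaN \<eta>)}"
  unfolding open_betaN_def by (auto intro: generate_topology.Basis)

lemma eventually_nhds_betaN:
  assumes "eventually P (Rep_betaN \<eta>)"
  shows "eventually (\<lambda>\<xi>. eventually P (Rep_betaN \<xi>)) (nhds \<eta>)"
  using eventually_nhds_in_open[OF open_betaN_basic, of \<eta> "Collect P"] assms by simp

text \<open>An ultrafilter \<open>V\<close> below the given filter converges to the ultrafilter of
  those \<open>P\<close> that hold along \<open>\<xi>\<close> for \<open>V\<close>-almost all
  \<open>\<xi>\<close>; this limit is a cluster point of the given filter.\<close>

lemma compact_UNIV_betaN: "compact (UNIV :: betaN set)"
  unfolding compact_filter
proof safe
  fix G :: "betaN filter"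
  assume "G \<noteq> bot"
  then obtain V where V: "ultrafilter V" "V \<le> G"
    using ex_ultrafilter_le by blast
  define F where "F = Abs_filter (\<lambda>P. eventually (\<lambda>\<xi>. eventually P (Rep_betaN \<xi>)) V)"
  have F: "eventually P F \<longleftrightarrow> eventually (\<lambda>\<xi>. eventually P (Rep_betaN \<xi>)) V" for P
    unfolding F_def
  proof (rule eventually_Abs_filter, rule is_filter.intro)
    fix P Q
    assume "eventually (\<lambda>\<xi>. eventually P (Rep_betaN \<xi>)) V"
      and "eventually (\<lambda>\<xi>. eventually Q (Rep_betaN \<xi>)) V"
    then show "eventually (\<lambda>\<xi>. eventually (\<lambda>x. P x \<and> Q x) (Rep_betaN \<xi>)) V"
      by eventually_elim (rule eventually_conj)
  next
    fix P Q :: "posnat \<Rightarrow> bool"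
    assume PQ: "\<forall>x. P x \<longrightarrow> Q x" and "eventually (\<lambda>\<xi>. eventually P (Rep_betaN \<xi>)) V"
    from this(2) show "eventually (\<lambda>\<xi>. eventually Q (Rep_betaN \<xi>)) V"
      by eventually_elim (use PQ in \<open>auto elim: eventually_mono\<close>)
  qed simp
  have "ultrafilter F"
    unfolding ultrafilter_def
  proof (intro conjI allI)
    show "F \<noteq> bot"
    proof
      assume "F = bot"
      then have "eventually (\<lambda>\<xi>. eventually (\<lambda>x. False) (Rep_betaN \<xi>)) V"
        unfolding F[symmetric] by simp
      then have "eventually (\<lambda>\<xi>. False) V"
        by (simp flip: trivial_limit_def)
      with V(1) show False
        by (simp add: ultrafilter_def trivial_limit_def)
    qed
    fix P
    have "eventually (\<lambda>x. \<not> P x) (Rep_betaN \<xi>)" if "\<not> eventually P (Rep_betaN \<xi>)" for \<xi>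
      using that ultrafilter_Rep_betaN[of \<xi>] by (auto simp only: ultrafilter_def)
    then have "eventually (\<lambda>\<xi>. eventually (\<lambda>x. \<not> P x) (Rep_betaN \<xi>)) V"
      if "eventually (\<lambda>\<xi>. \<not> eventually P (Rep_betaN \<xi>)) V"
      using that by (rule eventually_mono[rotated])
    with V(1) show "eventually P F \<or> eventually (\<lambda>x. \<not> P x) F"
      unfolding F ultrafilter_def by blast
  qed
  then obtain \<eta> where \<eta>: "Rep_betaN \<eta> = F"
    using Abs_betaN_inverse by blast
  \<comment> \<open>Neighbourhoods are generated by the sets in \<open>open_betaN_def\<close>, and
    for these the claim is the definition of \<open>F\<close>.\<close>
  have "V \<le> nhds \<eta>"
    unfolding nhds_generated_topology[OF open_betaN_def]
    by (auto intro!: INF_greatest simp: le_principal \<eta> F)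
  with V have "V \<le> inf (nhds \<eta>) G"
    by simp
  moreover have "V \<noteq> bot"
    using V(1) by (simp add: ultrafilter_def)
  ultimately show "\<exists>\<eta>\<in>UNIV. inf (nhds \<eta>) G \<noteq> bot"
    by (metis UNIV_I bot_unique)
qed

section \<open>Freeness as divergence to infinity\<close>

lemma nat_of_posnat_of_nat [simp]: "1 \<le> i \<Longrightarrow> nat_of_posnat (posnat_of_nat i) = i"
  by (simp add: posnat_of_nat_inverse)

lemma nat_of_posnat_ge_1 [simp]: "1 \<le> nat_of_posnat n" "Suc 0 \<le> nat_of_posnat n" "0 < nat_of_posnat n"
  using nat_of_posnat[of n] by simp_all

lemma eventually_eq_imp_betaN_of:
  assumes "eventually (\<lambda>n. n = m) (Rep_betaN \<eta>)"
  shows "\<eta> = betaN_of m"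
proof -
  have "Rep_betaN \<eta> \<le> principal {m}"
    using assms by (simp add: le_principal)
  then have "Rep_betaN \<eta> = principal {m}"
    by (intro ultrafilter_le_eq ultrafilter_principal) auto
  then show ?thesis
    by (metis Rep_betaN_of Rep_betaN_inject)
qed

text \<open>A nonprincipal ultrafilter contains the complement of every singleton, hence of every
  finite initial segment. In this form freeness supplies the limits at infinity used below.\<close>

lemma Nstar_iff_at_top: "\<eta> \<in> Nstar \<longleftrightarrow> filterlim nat_of_posnat at_top (Rep_betaN \<eta>)"
proof
  assume "\<eta> \<in> Nstar"
  then have "\<not> eventually (\<lambda>n. n = m) (Rep_betaN \<eta>)" for m
    using eventually_eq_imp_betaN_of by (auto simp: Nstar_def)
  then have neq: "eventually (\<lambda>n. n \<noteq> m) (Rep_betaN \<eta>)" for m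
    using ultrafilter_Rep_betaN[of \<eta>] by (auto simp only: ultrafilter_def)
  show "filterlim nat_of_posnat at_top (Rep_betaN \<eta>)"
    unfolding filterlim_at_top
  proof
    fix N
    have "finite (posnat_of_nat ` {..<N})"
      by simp
    then have "eventually (\<lambda>n. \<forall>m\<in>posnat_of_nat ` {..<N}. n \<noteq> m) (Rep_betaN \<eta>)"
      using neq by (intro eventually_ball_finite) auto
    then show "eventually (\<lambda>n. N \<le> nat_of_posnat n) (Rep_betaN \<eta>)"
      by eventually_elim (metis imageI lessThan_iff nat_of_posnat_inverse not_le)
  qed
next
  assume *: "filterlim nat_of_posnat at_top (Rep_betaN \<eta>)"
  show "\<eta> \<in> Nstar"
    unfolding Nstar_def
  proof (rule DiffI[OF UNIV_I], rule notI, erule rangeE)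
    fix m assume "\<eta> = betaN_of m"
    moreover have "eventually (\<lambda>n. Suc (nat_of_posnat m) \<le> nat_of_posnat n) (Rep_betaN \<eta>)"
      using * unfolding filterlim_at_top by blast
    ultimately show False
      by (simp add: Rep_betaN_of eventually_principal)
  qed
qed

text \<open>The basic open set given by \<open>{m}\<close> is the single point
  \<open>betaN_of m\<close>, so \<open>range betaN_of\<close> is open.\<close>

lemma closed_Nstar: "closed Nstar"
proof -
  have "{\<eta>. eventually (\<lambda>n. n \<in> {m}) (Rep_betaN \<eta>)} = {betaN_of m}" for m
    using eventually_eq_imp_betaN_of by (auto simp: Rep_betaN_of eventually_principal)
  then have "open {betaN_of m}" for m
    by (metis open_betaN_basic)
  then have "open (\<Union>m. {betaN_of m})"
    by blast
  moreover have "(\<Union>m. {betaN_of m}) = range betaN_of"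
    by blast
  ultimately show ?thesis
    by (simp add: Nstar_def closed_def Compl_eq_Diff_UNIV[symmetric])
qed

lemma tau_in_Nstar_iff: "tau \<eta> \<in> Nstar \<longleftrightarrow> \<eta> \<in> Nstar"
proof -
  have "filterlim (\<lambda>x. Suc (h x)) at_top F \<longleftrightarrow> filterlim h at_top F" for h :: "'a \<Rightarrow> nat" and F
    unfolding filterlim_at_top
    by (metis (mono_tags, lifting) eventually_mono le_Suc_eq Suc_le_mono)
  then show ?thesis
    by (simp add: Nstar_iff_at_top tau.rep_eq filterlim_filtermap posnat_Suc.rep_eq)
qed

section \<open>Comparing averages at different scales\<close>

text \<open>The divisor is \<open>x\<close> itself and not its integer part, as in
  \<open>phi_point\<close>; at a positive integer this is the Cesaro mean of
  \<open>phi_ultra\<close>.\<close>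

definition avg :: "linf \<Rightarrow> real \<Rightarrow> real" where
  "avg f x = 1 / x * (\<Sum>i = 1..nat \<lfloor>x\<rfloor>. f (posnat_of_nat i))"

lemma abs_sum_linf_le:
  fixes f :: linf
  shows "\<bar>\<Sum>i\<in>A. f (g i)\<bar> \<le> real (card A) * norm f"
proof -
  have "norm (\<Sum>i\<in>A. f (g i)) \<le> (\<Sum>i\<in>A. norm f)"
    by (rule sum_norm_le) (rule norm_bounded)
  then show ?thesis
    by simp
qed

lemma avg_bound: "0 < x \<Longrightarrow> \<bar>avg f x\<bar> \<le> norm f"
proof -
  assume x: "0 < x"
  have "\<bar>\<Sum>i = 1..nat \<lfloor>x\<rfloor>. f (posnat_of_nat i)\<bar> \<le> real (nat \<lfloor>x\<rfloor>) * norm f"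
    using abs_sum_linf_le[of f posnat_of_nat "{1..nat \<lfloor>x\<rfloor>}"] by simp
  also have "\<dots> \<le> x * norm f"
    using x by (intro mult_right_mono norm_ge_zero) linarith
  finally show ?thesis
    using x by (simp add: avg_def abs_mult field_simps)
qed

text \<open>Passing from \<open>x\<close> to \<open>y\<close> moves the partial sum by at most
  \<open>norm f * (\<bar>x - y\<bar> + 1)\<close>, the 1 coming from rounding; the change of divisor
  contributes the second \<open>\<bar>x - y\<bar>\<close>.\<close>

lemma avg_diff:
  assumes "0 < x" "0 < y"
  shows "\<bar>avg f x - avg f y\<bar> \<le> norm f * (2 * \<bar>x - y\<bar> + 1) / y"
proof -
  define S where "S x = (\<Sum>i = 1..nat \<lfloor>x\<rfloor>. f (posnat_of_nat i))" for x :: real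
  have main: "\<bar>avg f a - avg f b\<bar> \<le> norm f * (2 * (b - a) + 1) / b" if "0 < a" "a \<le> b" for a b
  proof -
    have "nat \<lfloor>a\<rfloor> \<le> nat \<lfloor>b\<rfloor>"
      using that by (intro nat_mono floor_mono)
    then have "{1..nat \<lfloor>b\<rfloor>} = {1..nat \<lfloor>a\<rfloor>} \<union> {nat \<lfloor>a\<rfloor> + 1..nat \<lfloor>b\<rfloor>}"
      by auto
    then have "S b = S a + (\<Sum>i = nat \<lfloor>a\<rfloor> + 1..nat \<lfloor>b\<rfloor>. f (posnat_of_nat i))"
      unfolding S_def by (simp only:) (subst sum.union_disjoint; auto)
    then have "\<bar>S b - S a\<bar> \<le> real (nat \<lfloor>b\<rfloor> - nat \<lfloor>a\<rfloor>) * norm f"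
      using abs_sum_linf_le[of f posnat_of_nat "{nat \<lfloor>a\<rfloor> + 1..nat \<lfloor>b\<rfloor>}"] by simp
    also have "real (nat \<lfloor>b\<rfloor> - nat \<lfloor>a\<rfloor>) \<le> b - a + 1"
      using that by linarith
    finally have 1: "\<bar>S b - S a\<bar> \<le> (b - a + 1) * norm f"
      by (simp add: mult_right_mono)
    have 2: "\<bar>avg f a * (b - a)\<bar> \<le> norm f * (b - a)"
      using that avg_bound[of a f] by (simp add: abs_mult mult_right_mono)
    have avg: "avg f x = S x / x" for x
      by (simp add: avg_def S_def)
    have "b * (avg f a - avg f b) = avg f a * (b - a) - (S b - S a)"
      using that by (simp add: avg field_simps)
    then have "\<bar>b\<bar> * \<bar>avg f a - avg f b\<bar> \<le> \<bar>avg f a * (b - a)\<bar> + \<bar>S b - S a\<bar>"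
      by (metis abs_mult abs_triangle_ineq4)
    also have "\<dots> \<le> norm f * (2 * (b - a) + 1)"
      using add_mono[OF 2 1] by (simp add: algebra_simps)
    finally have "b * \<bar>avg f a - avg f b\<bar> \<le> norm f * (2 * (b - a) + 1)"
      using that by simp
    then show ?thesis
      using that by (simp add: field_simps)
  qed
  show ?thesis
  proof (cases "x \<le> y")
    case True
    with main[OF assms(1)] show ?thesis by simp
  next
    case False
    then have "\<bar>avg f y - avg f x\<bar> \<le> norm f * (2 * (x - y) + 1) / x"
      using main[OF assms(2)] by simp
    \<comment> \<open>The estimate \<open>main\<close> divides by the larger argument, here
      \<open>x\<close>; the smaller divisor \<open>y\<close> only weakens it.\<close>
    also have "\<dots> \<le> norm f * (2 * (x - y) + 1) / y"
      using False assms by (intro divide_left_mono mult_nonneg_nonneg mult_pos_pos) auto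
    finally show ?thesis
      using False by (simp add: abs_minus_commute)
  qed
qed

text \<open>The bound of \<open>avg_diff\<close> equals
  \<open>norm f * (2 * \<bar>x / y - 1\<bar> + 1 / y)\<close>, which tends to 0.\<close>

lemma avg_tendsto_cong:
  assumes lim: "((\<lambda>n. avg f (x n)) \<longlongrightarrow> L) F"
    and pos: "\<And>n. 0 < x n" "\<And>n. 0 < y n"
    and y: "filterlim y at_top F"
    and ratio: "((\<lambda>n. x n / y n) \<longlongrightarrow> 1) F"
  shows "((\<lambda>n. avg f (y n)) \<longlongrightarrow> L) F"
proof -
  have inv: "((\<lambda>n. 1 / y n) \<longlongrightarrow> 0) F"
    using tendsto_inverse_0_at_top[OF y] by (simp add: inverse_eq_divide)
  have "((\<lambda>n. norm f * (2 * \<bar>x n / y n - 1\<bar> + 1 / y n)) \<longlongrightarrow> norm f * (2 * \<bar>1 - 1\<bar> + 0)) F"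
    by (intro tendsto_intros ratio inv)
  then have *: "((\<lambda>n. norm f * (2 * \<bar>x n / y n - 1\<bar> + 1 / y n)) \<longlongrightarrow> 0) F"
    by simp
  have "((\<lambda>n. avg f (x n) - avg f (y n)) \<longlongrightarrow> 0) F"
  proof (rule Lim_null_comparison[OF always_eventually *], rule allI)
    fix n
    have "norm f * (2 * \<bar>x n / y n - 1\<bar> + 1 / y n) = norm f * (2 * \<bar>x n - y n\<bar> + 1) / y n"
      using pos(2)[of n] by (simp add: field_simps abs_if)
    then show "norm (avg f (x n) - avg f (y n)) \<le> norm f * (2 * \<bar>x n / y n - 1\<bar> + 1 / y n)"
      using avg_diff[OF pos(1)[of n] pos(2)[of n], of f]
      by simp
  qed
  from tendsto_diff[OF lim this] show ?thesis
    by simp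
qed

lemma phi_point_tendsto:
  "((\<lambda>n. avg f (2 powr t * 2 ^ nat_of_posnat n)) \<longlongrightarrow> phi_point \<eta> t f) (Rep_betaN \<eta>)"
  unfolding phi_point_apply avg_def[symmetric]
  by (rule ultrafilter_tendsto_Lim[where B = "norm f"]) (simp_all add: avg_bound)

lemma phi_ultra_tendsto:
  "((\<lambda>n. avg f (real (nat_of_posnat n))) \<longlongrightarrow> phi_ultra U f) (Rep_betaN U)"
proof -
  have "phi_ultra U f = Lim (Rep_betaN U) (\<lambda>n. avg f (real (nat_of_posnat n)))"
    by (simp add: phi_ultra_apply avg_def)
  then show ?thesis
    by (auto intro: ultrafilter_tendsto_Lim[where B = "norm f"] simp: avg_bound)
qed

lemma filterlim_power2_Nstar:
  assumes "\<eta> \<in> Nstar"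
  shows "filterlim (\<lambda>n. 2 powr t * 2 ^ nat_of_posnat n :: real) at_top (Rep_betaN \<eta>)"
proof -
  have "filterlim (\<lambda>n. 2 ^ n :: real) at_top sequentially"
    by real_asymp
  from filterlim_compose[OF this] assms
  have "filterlim (\<lambda>n. 2 ^ nat_of_posnat n :: real) at_top (Rep_betaN \<eta>)"
    by (auto simp: Nstar_iff_at_top)
  then show ?thesis
    by (intro filterlim_tendsto_pos_mult_at_top[OF tendsto_const]) auto
qed

lemma floor_ratio_tendsto:
  fixes x :: "'a \<Rightarrow> real"
  assumes "filterlim x at_top F"
  shows "((\<lambda>n. x n / of_int \<lfloor>x n\<rfloor>) \<longlongrightarrow> 1) F"
    and "((\<lambda>n. of_int \<lfloor>x n\<rfloor> / x n) \<longlongrightarrow> 1) F"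
proof -
  have "((\<lambda>x::real. x / of_int \<lfloor>x\<rfloor>) \<longlongrightarrow> 1) at_top"
    and "((\<lambda>x::real. of_int \<lfloor>x\<rfloor> / x) \<longlongrightarrow> 1) at_top"
    by real_asymp+
  from this[THEN filterlim_compose, OF assms]
  show "((\<lambda>n. x n / of_int \<lfloor>x n\<rfloor>) \<longlongrightarrow> 1) F"
    and "((\<lambda>n. of_int \<lfloor>x n\<rfloor> / x n) \<longlongrightarrow> 1) F"
    by auto
qed

section \<open>Injectivity\<close>

text \<open>Prescribing the partial sums makes the average over \<open>{1..N}\<close> equal to \<open>u (log 2 N)\<close>, so
  that \<open>phi_point \<eta> t f\<close> is the limit of \<open>u (n + t)\<close> along \<open>\<eta>\<close>. Such functions separate the
  points of \<open>Omega_star\<close>.\<close>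

lemma ex_linf_sum_eq_log:
  fixes u :: "real \<Rightarrow> real"
  assumes B: "\<And>x. \<bar>u x\<bar> \<le> B" and L: "\<And>x y. \<bar>u x - u y\<bar> \<le> L * \<bar>x - y\<bar>"
  shows "\<exists>f::linf. \<forall>N. (\<Sum>i = 1..N. f (posnat_of_nat i)) = real N * u (log 2 (real N))"
proof -
  define v where "v i = real i * u (log 2 (real i))" for i
  define g where "g n = v (nat_of_posnat n) - v (nat_of_posnat n - 1)" for n
  have L0: "0 \<le> L"
    using L[of 1 0] by simp
  have bound: "\<bar>v (Suc j) - v j\<bar> \<le> B + L / ln 2" for j
  proof (cases "j = 0")
    case True
    have "\<bar>u 0\<bar> \<le> B" "0 \<le> L / ln 2"
      using B L0 by auto
    with True show ?thesis
      by (simp add: v_def)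
  next
    case False
    \<comment> \<open>The increment of the logarithm is at most \<open>1 / (j * ln 2)\<close>, which
      compensates the weight \<open>j\<close> in \<open>v\<close>.\<close>
    have "log 2 (real (Suc j)) - log 2 (real j) = ln (1 + 1 / real j) / ln 2"
      using False by (simp add: log_def ln_div field_simps flip: diff_divide_distrib)
    also have "\<dots> \<le> (1 / real j) / ln 2"
      by (intro divide_right_mono ln_add_one_self_le_self) auto
    finally have d: "log 2 (real (Suc j)) - log 2 (real j) \<le> 1 / real j / ln 2" .
    have "\<bar>u (log 2 (real (Suc j))) - u (log 2 (real j))\<bar> \<le> L * (log 2 (real (Suc j)) - log 2 (real j))"
      using L[of "log 2 (real (Suc j))" "log 2 (real j)"] False by simp
    also have "\<dots> \<le> L * (1 / real j / ln 2)"
      by (intro mult_left_mono d L0)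
    finally have "real j * \<bar>u (log 2 (real (Suc j))) - u (log 2 (real j))\<bar> \<le> L / ln 2"
      using False by (simp add: field_simps)
    moreover have "v (Suc j) - v j = u (log 2 (real (Suc j))) + real j * (u (log 2 (real (Suc j))) - u (log 2 (real j)))"
      by (simp add: v_def algebra_simps)
    then have "\<bar>v (Suc j) - v j\<bar> \<le> \<bar>u (log 2 (real (Suc j)))\<bar>
        + real j * \<bar>u (log 2 (real (Suc j))) - u (log 2 (real j))\<bar>"
      by (metis abs_mult abs_of_nat abs_triangle_ineq)
    ultimately show ?thesis
      using B[of "log 2 (real (Suc j))"] by linarith
  qed
  have "g \<in> bcontfun"
  proof (rule bcontfun_normI)
    fix n
    obtain j where "nat_of_posnat n = Suc j"
      using nat_of_posnat_ge_1(3) gr0_implies_Suc by blast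
    with bound[of j] show "norm (g n) \<le> B + L / ln 2"
      by (simp add: g_def)
  qed simp
  then have g: "apply_bcontfun (Bcontfun g) = g"
    by (rule Bcontfun_inverse)
  \<comment> \<open>The sum telescopes, and \<open>v 0 = 0\<close> by the weight \<open>i\<close>,
    whatever the value of \<open>log 2 0\<close>.\<close>
  have "(\<Sum>i = 1..N. g (posnat_of_nat i)) = v N" for N
    by (induction N) (simp_all add: g_def, simp add: v_def)
  with g show ?thesis
    unfolding v_def by metis
qed

lemma filterlim_of_int_floor_at_top:
  "filterlim x at_top F \<Longrightarrow> filterlim (\<lambda>n. of_int \<lfloor>x n :: real\<rfloor> :: real) at_top F"
proof -
  have "filterlim (\<lambda>x::real. of_int \<lfloor>x\<rfloor> :: real) at_top at_top"
    by real_asymp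
  then show "filterlim x at_top F \<Longrightarrow> filterlim (\<lambda>n. of_int \<lfloor>x n\<rfloor> :: real) at_top F"
    by (rule filterlim_compose)
qed

lemma one_le_floor_powr:
  assumes "0 \<le> t"
  shows "1 \<le> \<lfloor>2 powr t * 2 ^ m :: real\<rfloor>"
proof -
  have "1 * 1 \<le> 2 powr t * (2 ^ m :: real)"
    using assms by (intro mult_mono) (auto simp: ge_one_powr_ge_zero)
  then show ?thesis
    by (simp add: le_floor_iff)
qed

text \<open>Rounding changes the scale by a ratio tending to 1. Integer scales give access to
  prescribed partial sums and to \<open>phi_ultra\<close>; \<open>0 \<le> t\<close> keeps them
  positive.\<close>

lemma avg_floor_tendsto:
  assumes "\<eta> \<in> Nstar" "0 \<le> t"
  shows "((\<lambda>n. avg f (of_int \<lfloor>2 powr t * 2 ^ nat_of_posnat n\<rfloor>)) \<longlongrightarrow> phi_point \<eta> t f) (Rep_betaN \<eta>)"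
proof (rule avg_tendsto_cong[OF phi_point_tendsto])
  show "0 < (of_int \<lfloor>2 powr t * 2 ^ nat_of_posnat n\<rfloor> :: real)" for n
    using one_le_floor_powr[OF assms(2), of "nat_of_posnat n"] by linarith
qed (use filterlim_power2_Nstar[OF assms(1)] in
    \<open>simp_all add: filterlim_of_int_floor_at_top floor_ratio_tendsto\<close>)

text \<open>The average at the rounded scale is \<open>u\<close> at its logarithm, which differs
  from \<open>n + t\<close> by the logarithm of a ratio tending to 1; the Lipschitz bound makes this
  error vanish.\<close>

lemma phi_point_sum_eq_log:
  fixes f :: linf
  assumes "\<eta> \<in> Nstar" "0 \<le> t"
    and f: "\<And>N. (\<Sum>i = 1..N. f (posnat_of_nat i)) = real N * u (log 2 (real N))"
    and L: "\<And>x y. \<bar>u x - u y\<bar> \<le> L * \<bar>x - y\<bar>"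
  shows "((\<lambda>n. u (real (nat_of_posnat n) + t)) \<longlongrightarrow> phi_point \<eta> t f) (Rep_betaN \<eta>)"
proof -
  define x :: "posnat \<Rightarrow> real" where "x n = 2 powr t * 2 ^ nat_of_posnat n" for n
  have x: "filterlim x at_top (Rep_betaN \<eta>)"
    using filterlim_power2_Nstar[OF assms(1)] by (simp add: x_def[abs_def])
  have floor_pos: "1 \<le> \<lfloor>x n\<rfloor>" for n
    using one_le_floor_powr[OF assms(2)] by (simp add: x_def)
  have "avg f (of_int \<lfloor>x n\<rfloor>) = u (log 2 (of_int \<lfloor>x n\<rfloor>))" for n
  proof -
    have "real (nat \<lfloor>x n\<rfloor>) = of_int \<lfloor>x n\<rfloor>" "of_int \<lfloor>x n\<rfloor> \<noteq> (0::real)"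
      using floor_pos[of n] by linarith+
    then show ?thesis
      by (simp only: avg_def floor_of_int f) simp
  qed
  then have lim: "((\<lambda>n. u (log 2 (of_int \<lfloor>x n\<rfloor>))) \<longlongrightarrow> phi_point \<eta> t f) (Rep_betaN \<eta>)"
    using avg_floor_tendsto[OF assms(1,2), of f] by (simp add: x_def)
  have "((\<lambda>n. log 2 (of_int \<lfloor>x n\<rfloor> / x n)) \<longlongrightarrow> log 2 1) (Rep_betaN \<eta>)"
    by (intro tendsto_intros floor_ratio_tendsto x) auto
  from tendsto_mult_left[OF tendsto_rabs[OF this]]
  have "((\<lambda>n. L * \<bar>log 2 (of_int \<lfloor>x n\<rfloor> / x n)\<bar>) \<longlongrightarrow> L * \<bar>log 2 1\<bar>) (Rep_betaN \<eta>)" .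
  then have null: "((\<lambda>n. L * \<bar>log 2 (of_int \<lfloor>x n\<rfloor> / x n)\<bar>) \<longlongrightarrow> 0) (Rep_betaN \<eta>)"
    by simp
  have "((\<lambda>n. u (log 2 (of_int \<lfloor>x n\<rfloor>)) - u (real (nat_of_posnat n) + t)) \<longlongrightarrow> 0) (Rep_betaN \<eta>)"
  proof (rule Lim_null_comparison[OF always_eventually null], rule allI)
    fix n
    have "0 < x n"
      by (simp add: x_def)
    moreover have "log 2 (x n) = real (nat_of_posnat n) + t"
      by (simp add: x_def log_mult log_nat_power)
    moreover have "\<lfloor>x n\<rfloor> \<noteq> 0"
      using floor_pos[of n] by linarith
    ultimately have "log 2 (of_int \<lfloor>x n\<rfloor> / x n) = log 2 (of_int \<lfloor>x n\<rfloor>) - (real (nat_of_posnat n) + t)"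
      by (simp add: log_divide)
    then show "norm (u (log 2 (of_int \<lfloor>x n\<rfloor>)) - u (real (nat_of_posnat n) + t))
        \<le> L * \<bar>log 2 (of_int \<lfloor>x n\<rfloor> / x n)\<bar>"
      using L by simp
  qed
  from tendsto_diff[OF lim this] show ?thesis
    by simp
qed

text \<open>The test function is the truncated distance to the points \<open>m + t\<close> with
  \<open>P m\<close>. It vanishes eventually along \<open>\<eta>\<close>, so equality of the
  functionals makes its limit along \<open>\<eta>'\<close> zero too.\<close>

lemma phi_point_eq_imp_eventually_close:
  assumes Ns: "\<eta> \<in> Nstar" "\<eta>' \<in> Nstar" and t: "0 \<le> t" "0 \<le> t'"
    and eq: "phi_point \<eta> t = phi_point \<eta>' t'"
    and P: "eventually P (Rep_betaN \<eta>)" and \<delta>: "0 < \<delta>" "\<delta> \<le> 1"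
  shows "eventually (\<lambda>n. \<exists>m. P m \<and>
    \<bar>real (nat_of_posnat n) + t' - (real (nat_of_posnat m) + t)\<bar> < \<delta>) (Rep_betaN \<eta>')"
proof -
  define B where "B = {real (nat_of_posnat m) + t | m. P m}"
  define u where "u x = min 1 (infdist x B)" for x
  have "B \<noteq> {}"
    using eventually_happens'[OF Rep_betaN_neq_bot P] by (auto simp: B_def)
  have L: "\<bar>u x - u y\<bar> \<le> 1 * \<bar>x - y\<bar>" for x y
    using infdist_triangle_abs[of x B y] by (auto simp: u_def dist_real_def min_def)
  have "\<bar>u x\<bar> \<le> 1" for x
    using infdist_nonneg[of x B] by (auto simp: u_def min_def)
  from ex_linf_sum_eq_log[OF this L] obtain f :: linf
    where f: "\<And>N. (\<Sum>i = 1..N. f (posnat_of_nat i)) = real N * u (log 2 (real N))"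
    by blast
  have "eventually (\<lambda>n. u (real (nat_of_posnat n) + t) = 0) (Rep_betaN \<eta>)"
    using P
  proof eventually_elim
    case (elim n)
    then have "real (nat_of_posnat n) + t \<in> B"
      by (auto simp: B_def)
    then show ?case
      by (simp add: u_def)
  qed
  then have "((\<lambda>n. u (real (nat_of_posnat n) + t)) \<longlongrightarrow> 0) (Rep_betaN \<eta>)"
    by (rule tendsto_eventually)
  with phi_point_sum_eq_log[OF Ns(1) t(1) f L] have "phi_point \<eta> t f = 0"
    by (rule tendsto_unique[OF Rep_betaN_neq_bot])
  with phi_point_sum_eq_log[OF Ns(2) t(2) f L]
  have "((\<lambda>n. u (real (nat_of_posnat n) + t')) \<longlongrightarrow> 0) (Rep_betaN \<eta>')"
    by (simp add: eq)
  then have "eventually (\<lambda>n. u (real (nat_of_posnat n) + t') < \<delta>) (Rep_betaN \<eta>')"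
    using \<delta>(1) by (rule order_tendstoD)
  then show ?thesis
  proof eventually_elim
    case (elim n)
    show ?case
    proof (rule ccontr)
      assume "\<not> ?thesis"
      then have "\<delta> \<le> infdist (real (nat_of_posnat n) + t') B"
        using \<open>B \<noteq> {}\<close> by (force simp: B_def infdist_notempty dist_real_def intro!: cINF_greatest)
      \<comment> \<open>As \<open>\<delta> \<le> 1\<close>, truncation at 1 still leaves
        \<open>u\<close> at least \<open>\<delta>\<close> here.\<close>
      with elim \<delta> show False
        by (simp add: u_def)
    qed
  qed
qed

lemma phi_point_inj:
  assumes Ns: "\<eta> \<in> Nstar" "\<eta>' \<in> Nstar" and t: "t \<in> {0..<1}" "t' \<in> {0..<1}"
    and eq: "phi_point \<eta> t = phi_point \<eta>' t'"
  shows "\<eta> = \<eta>' \<and> t = t'"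
proof -
  have t0: "0 \<le> t" "0 \<le> t'"
    using t by auto
  note close = phi_point_eq_imp_eventually_close[OF Ns t0 eq]
  have tt: "t = t'"
  proof (rule ccontr)
    assume "t \<noteq> t'"
    \<comment> \<open>The distance from \<open>t' - t\<close> to the nearest integer; with
      \<open>P\<close> trivially true, closeness would bring an integer nearer than that to
      \<open>t - t'\<close>.\<close>
    define \<delta> where "\<delta> = min \<bar>t' - t\<bar> (1 - \<bar>t' - t\<bar>)"
    have "0 < \<delta>" "\<delta> \<le> 1"
      using t \<open>t \<noteq> t'\<close> by (auto simp: \<delta>_def)
    from eventually_happens'[OF Rep_betaN_neq_bot close[OF _ this, of "\<lambda>_. True"]]
    obtain n m where "\<bar>real (nat_of_posnat n) + t' - (real (nat_of_posnat m) + t)\<bar> < \<delta>"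
      by auto
    then have *: "\<bar>of_int (int (nat_of_posnat n) - int (nat_of_posnat m)) + (t' - t)\<bar> < \<delta>"
      by (simp add: algebra_simps)
    have "\<bar>of_int k + (t' - t)\<bar> \<ge> \<delta>" for k :: int
    proof (cases "k = 0")
      case False
      then have "\<bar>of_int k :: real\<bar> \<ge> 1"
        by linarith
      then show ?thesis
        unfolding \<delta>_def by linarith
    qed (simp add: \<delta>_def)
    from this[of "int (nat_of_posnat n) - int (nat_of_posnat m)"] * show False
      by linarith
  qed
  \<comment> \<open>For \<open>t = t'\<close> and \<open>\<delta> = 1\<close>, closeness forces
    \<open>n = m\<close>, so \<open>P\<close> carries over from \<open>\<eta>\<close> to
    \<open>\<eta>'\<close>.\<close>
  have "Rep_betaN \<eta>' \<le> Rep_betaN \<eta>"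
  proof (rule filter_leI)
    fix P assume "eventually P (Rep_betaN \<eta>)"
    from close[OF this zero_less_one order_refl] show "eventually P (Rep_betaN \<eta>')"
    proof eventually_elim
      case (elim n)
      then obtain m where "P m" "\<bar>real (nat_of_posnat n) - real (nat_of_posnat m)\<bar> < 1"
        using tt by auto
      then have "nat_of_posnat n = nat_of_posnat m"
        by linarith
      with \<open>P m\<close> show ?case
        by (simp add: nat_of_posnat_inject)
    qed
  qed
  then have "Rep_betaN \<eta>' = Rep_betaN \<eta>"
    by (intro ultrafilter_le_eq) auto
  with tt show ?thesis
    by (simp add: Rep_betaN_inject)
qed

section \<open>Surjectivity\<close>

lemma Rep_betaN_filtermap: "\<exists>\<xi>. Rep_betaN \<xi> = filtermap h (Rep_betaN \<eta>)"
  using Abs_betaN_inverse[of "filtermap h (Rep_betaN \<eta>)"] by (auto simp: ultrafilter_filtermap)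

lemma Nstar_iff_real_at_top:
  "\<eta> \<in> Nstar \<longleftrightarrow> filterlim (\<lambda>n. real (nat_of_posnat n)) at_top (Rep_betaN \<eta>)"
  by (simp add: Nstar_iff_at_top filterlim_sequentially_iff_filterlim_real)

lemma phi_point_in_C_tilde:
  assumes "\<eta> \<in> Nstar" "0 \<le> t"
  shows "phi_point \<eta> t \<in> C_tilde"
proof -
  define h where "h n = posnat_of_nat (nat \<lfloor>2 powr t * 2 ^ nat_of_posnat n\<rfloor>)" for n
  have h: "real (nat_of_posnat (h n)) = of_int \<lfloor>2 powr t * 2 ^ nat_of_posnat n\<rfloor>" for n
    using one_le_floor_powr[OF assms(2), of "nat_of_posnat n"] by (simp add: h_def nat_le_iff le_nat_iff)
  obtain U where U: "Rep_betaN U = filtermap h (Rep_betaN \<eta>)"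
    using Rep_betaN_filtermap by blast
  have "U \<in> Nstar"
    unfolding Nstar_iff_real_at_top U filterlim_filtermap h
    by (intro filterlim_of_int_floor_at_top filterlim_power2_Nstar assms)
  moreover have "phi_point \<eta> t = phi_ultra U"
  proof (rule blinfun_eqI)
    fix f
    have "((\<lambda>n. avg f (of_int \<lfloor>2 powr t * 2 ^ nat_of_posnat n\<rfloor>)) \<longlongrightarrow> phi_ultra U f) (Rep_betaN \<eta>)"
      using phi_ultra_tendsto[of f U] by (simp add: U filterlim_filtermap h)
    with avg_floor_tendsto[OF assms] show "phi_point \<eta> t f = phi_ultra U f"
      by (rule tendsto_unique[OF Rep_betaN_neq_bot])
  qed
  ultimately show ?thesis
    by (simp add: C_tilde_def)
qed

text \<open>Along \<open>U\<close>, the fractional part of the binary logarithm may converge to 1,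
  which is why \<open>t\<close> ranges over the closed interval.\<close>

lemma phi_ultra_eq_phi_point:
  assumes "U \<in> Nstar"
  shows "\<exists>\<eta>\<in>Nstar. \<exists>t\<in>{0..1}. phi_ultra U = phi_point \<eta> t"
proof -
  \<comment> \<open>The maximum only affects \<open>m = 1\<close>, whose logarithm 0 is not an index.\<close>
  define k where "k m = posnat_of_nat (max 1 (nat \<lfloor>log 2 (real (nat_of_posnat m))\<rfloor>))" for m
  define s where "s m = log 2 (real (nat_of_posnat m)) - real (nat_of_posnat (k m))" for m
  have k: "real (nat_of_posnat (k m)) = max 1 (of_int \<lfloor>log 2 (real (nat_of_posnat m))\<rfloor>)" for m
    by (simp add: k_def max_def le_nat_iff)
  have log0: "0 \<le> log 2 (real (nat_of_posnat m))" for m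
    using nat_of_posnat_ge_1(1)[of m] by simp
  \<comment> \<open>At index 1 the maximum makes \<open>s\<close> equal to -1, so this is the bound
    valid everywhere; values in \<open>[0, 1]\<close> are guaranteed only from 2 on.\<close>
  have "\<bar>s m\<bar> \<le> 1" for m
    unfolding s_def k using log0[of m] by linarith
  then have s: "(s \<longlongrightarrow> Lim (Rep_betaN U) s) (Rep_betaN U)"
    by (rule ultrafilter_tendsto_Lim[OF ultrafilter_Rep_betaN])
  define t where "t = Lim (Rep_betaN U) s"
  note s = s[folded t_def]
  have "eventually (\<lambda>m. 2 \<le> nat_of_posnat m) (Rep_betaN U)"
    using assms unfolding Nstar_iff_at_top filterlim_at_top by blast
  then have s01: "eventually (\<lambda>m. 0 \<le> s m \<and> s m \<le> 1) (Rep_betaN U)"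
  proof eventually_elim
    case (elim m)
    then have "1 \<le> log 2 (real (nat_of_posnat m))"
      by (simp add: le_log_iff)
    then show ?case
      unfolding s_def k by linarith
  qed
  have t: "t \<in> {0..1}"
    using tendsto_lowerbound[OF s, of 0] tendsto_upperbound[OF s, of 1] s01
    by (simp add: eventually_conj_iff)
  obtain \<eta> where \<eta>: "Rep_betaN \<eta> = filtermap k (Rep_betaN U)"
    using Rep_betaN_filtermap by blast
  have U_top: "filterlim (\<lambda>m. real (nat_of_posnat m)) at_top (Rep_betaN U)"
    using assms by (simp add: Nstar_iff_real_at_top)
  \<comment> \<open>A lower bound for \<open>k m\<close>, since the floor loses less than 1.\<close>
  have "filterlim (\<lambda>x::real. log 2 x - 1) at_top at_top"
    by real_asymp
  from filterlim_compose[OF this U_top]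
  have "filterlim (\<lambda>m. real (nat_of_posnat (k m))) at_top (Rep_betaN U)"
    by (rule filterlim_at_top_mono) (auto intro!: always_eventually simp: k, linarith)
  then have Ns: "\<eta> \<in> Nstar"
    by (simp add: Nstar_iff_real_at_top \<eta> filterlim_filtermap)
  have "phi_ultra U = phi_point \<eta> t"
  proof (rule blinfun_eqI)
    fix f
    let ?y = "\<lambda>m. 2 powr t * 2 ^ nat_of_posnat (k m) :: real"
    \<comment> \<open>The ratio of the two scales tends to 1 because \<open>s\<close> tends to
      \<open>t\<close>, so \<open>avg_tendsto_cong\<close> applies.\<close>
    have "real (nat_of_posnat m) / ?y m = 2 powr (s m - t)" for m
      by (simp add: s_def powr_diff powr_realpow mult.commute)
    moreover have "((\<lambda>m. 2 powr (s m - t)) \<longlongrightarrow> 2 powr (t - t)) (Rep_betaN U)"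
      by (intro tendsto_intros s) auto
    ultimately have ratio: "((\<lambda>m. real (nat_of_posnat m) / ?y m) \<longlongrightarrow> 1) (Rep_betaN U)"
      by simp
    have "filterlim ?y at_top (Rep_betaN U)"
      using filterlim_power2_Nstar[OF Ns, of t] by (simp add: \<eta> filterlim_filtermap)
    from avg_tendsto_cong[OF phi_ultra_tendsto _ _ this ratio]
    have "((\<lambda>m. avg f (?y m)) \<longlongrightarrow> phi_ultra U f) (Rep_betaN U)"
      by simp
    moreover have "((\<lambda>m. avg f (?y m)) \<longlongrightarrow> phi_point \<eta> t f) (Rep_betaN U)"
      using phi_point_tendsto[of f t \<eta>] by (simp add: \<eta> filterlim_filtermap)
    ultimately show "phi_ultra U f = phi_point \<eta> t f"
      by (rule tendsto_unique[OF Rep_betaN_neq_bot])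
  qed
  with Ns t show ?thesis
    by blast
qed

section \<open>Continuity and the quotient\<close>

text \<open>In \<open>avg_diff\<close> the factor \<open>2 ^ n\<close> cancels,
  \<open>2 powr s \<ge> 1\<close> is dropped from the divisor, and the rounding term vanishes by
  freeness. The bound is uniform in \<open>\<eta>\<close>.\<close>

lemma phi_point_diff_le:
  assumes "\<eta> \<in> Nstar" "0 \<le> s"
  shows "\<bar>phi_point \<eta> t f - phi_point \<eta> s f\<bar> \<le> norm f * (2 * \<bar>2 powr t - 2 powr s\<bar>)"
proof -
  let ?y = "\<lambda>n. 2 powr s * 2 ^ nat_of_posnat n :: real"
  have "((\<lambda>n. inverse (?y n)) \<longlongrightarrow> 0) (Rep_betaN \<eta>)"
    by (intro tendsto_inverse_0_at_top filterlim_power2_Nstar assms)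
  then have "((\<lambda>n. norm f * (2 * \<bar>2 powr t - 2 powr s\<bar> + inverse (?y n)))
      \<longlongrightarrow> norm f * (2 * \<bar>2 powr t - 2 powr s\<bar> + 0)) (Rep_betaN \<eta>)"
    by (intro tendsto_intros)
  moreover have "((\<lambda>n. \<bar>avg f (2 powr t * 2 ^ nat_of_posnat n) - avg f (?y n)\<bar>)
      \<longlongrightarrow> \<bar>phi_point \<eta> t f - phi_point \<eta> s f\<bar>) (Rep_betaN \<eta>)"
    by (intro tendsto_intros phi_point_tendsto)
  moreover have "\<bar>avg f (2 powr t * 2 ^ nat_of_posnat n) - avg f (?y n)\<bar>
      \<le> norm f * (2 * \<bar>2 powr t - 2 powr s\<bar> + inverse (?y n))" for n
  proof -
    have y: "0 < ?y n"
      by simp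
    have "2 powr t * 2 ^ nat_of_posnat n - ?y n = (2 powr t - 2 powr s) * 2 ^ nat_of_posnat n"
      by (simp add: left_diff_distrib)
    then have "\<bar>2 powr t * 2 ^ nat_of_posnat n - ?y n\<bar> = \<bar>2 powr t - 2 powr s\<bar> * 2 ^ nat_of_posnat n"
      by (simp add: abs_mult)
    also have "\<dots> \<le> \<bar>2 powr t - 2 powr s\<bar> * ?y n"
      using assms(2) by (intro mult_left_mono) (auto simp: ge_one_powr_ge_zero)
    finally have "(2 * \<bar>2 powr t * 2 ^ nat_of_posnat n - ?y n\<bar> + 1) / ?y n
        \<le> (2 * (\<bar>2 powr t - 2 powr s\<bar> * ?y n) + 1) / ?y n"
      using y by (intro divide_right_mono) auto
    also have "\<dots> = 2 * \<bar>2 powr t - 2 powr s\<bar> + inverse (?y n)"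
      using y by (simp add: add_divide_distrib inverse_eq_divide)
    finally have "norm f * ((2 * \<bar>2 powr t * 2 ^ nat_of_posnat n - ?y n\<bar> + 1) / ?y n)
        \<le> norm f * (2 * \<bar>2 powr t - 2 powr s\<bar> + inverse (?y n))"
      by (rule mult_left_mono) simp
    moreover have "\<bar>avg f (2 powr t * 2 ^ nat_of_posnat n) - avg f (?y n)\<bar>
        \<le> norm f * (2 * \<bar>2 powr t * 2 ^ nat_of_posnat n - ?y n\<bar> + 1) / ?y n"
      by (rule avg_diff) simp_all
    ultimately show ?thesis
      by simp
  qed
  ultimately show ?thesis
    by (intro tendsto_le[OF Rep_betaN_neq_bot]) (auto intro: always_eventually)
qed

text \<open>The averages are within \<open>e / 2\<close> of the limit on a set in
  \<open>\<eta>\<close>. The ultrafilters containing this set form a neighbourhood of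
  \<open>\<eta>\<close>, and their limits obey the same bound.\<close>

lemma tendsto_phi_point_nhds: "((\<lambda>\<xi>. phi_point \<xi> t f) \<longlongrightarrow> phi_point \<eta> t f) (nhds \<eta>)"
  unfolding tendsto_iff
proof safe
  fix e :: real assume "0 < e"
  let ?a = "\<lambda>n. avg f (2 powr t * 2 ^ nat_of_posnat n)"
  from phi_point_tendsto[of f t \<eta>] have "eventually (\<lambda>n. dist (?a n) (phi_point \<eta> t f) < e / 2) (Rep_betaN \<eta>)"
    using \<open>0 < e\<close> by (intro tendstoD) auto
  from eventually_nhds_betaN[OF this]
  show "eventually (\<lambda>\<xi>. dist (phi_point \<xi> t f) (phi_point \<eta> t f) < e) (nhds \<eta>)"
  proof eventually_elim
    case (elim \<xi>)
    have "dist (phi_point \<xi> t f) (phi_point \<eta> t f) \<le> e / 2"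
      by (rule tendsto_upperbound[OF tendsto_dist[OF phi_point_tendsto tendsto_const]])
        (use elim in \<open>auto elim: eventually_mono\<close>)
    with \<open>0 < e\<close> show ?case
      by simp
  qed
qed

lemma continuous_on_phi_point:
  "continuous_on (Nstar \<times> {0..1::real}) (\<lambda>p. phi_point (fst p) (snd p) f)"
  unfolding continuous_on_def
proof
  fix p :: "betaN \<times> real"
  assume p: "p \<in> Nstar \<times> {0..1}"
  let ?F = "at p within Nstar \<times> {0..1::real}"
  \<comment> \<open>Comparison through \<open>(fst q, snd p)\<close>: the first term is uniform in
    the ultrafilter, the second is continuity at fixed \<open>t\<close>.\<close>
  let ?b = "\<lambda>q. norm f * (2 * \<bar>2 powr snd q - 2 powr snd p\<bar>) +
    \<bar>phi_point (fst q) (snd p) f - phi_point (fst p) (snd p) f\<bar>"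
  have "((\<lambda>q. phi_point (fst q) (snd p) f) \<longlongrightarrow> phi_point (fst p) (snd p) f) ?F"
    by (rule filterlim_compose[OF tendsto_phi_point_nhds tendsto_fst[OF tendsto_ident_at]])
  moreover have "((\<lambda>q. 2 powr snd q) \<longlongrightarrow> 2 powr snd p) ?F"
    by (intro tendsto_intros tendsto_snd[OF tendsto_ident_at]) auto
  ultimately have "(?b \<longlongrightarrow> norm f * (2 * \<bar>2 powr snd p - 2 powr snd p\<bar>) +
    \<bar>phi_point (fst p) (snd p) f - phi_point (fst p) (snd p) f\<bar>) ?F"
    by (intro tendsto_add tendsto_mult_left tendsto_rabs tendsto_diff tendsto_const)
  then have b: "(?b \<longlongrightarrow> 0) ?F"
    by simp
  have "eventually (\<lambda>q. norm (phi_point (fst q) (snd q) f - phi_point (fst p) (snd p) f) \<le> ?b q) ?F"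
    unfolding eventually_at_filter
  proof (intro always_eventually allI impI)
    fix q :: "betaN \<times> real"
    assume "q \<in> Nstar \<times> {0..1}"
    with p show "norm (phi_point (fst q) (snd q) f - phi_point (fst p) (snd p) f) \<le> ?b q"
      using phi_point_diff_le[of "fst q" "snd p" "snd q" f] by auto
  qed
  from Lim_null_comparison[OF this b]
  show "((\<lambda>q. phi_point (fst q) (snd q) f) \<longlongrightarrow> phi_point (fst p) (snd p) f) ?F"
    by (rule LIM_zero_cancel)
qed

section \<open>\<open>Omega_star\<close> as a compact quotient\<close>

lemma topspace_cylinder: "topspace cylinder = UNIV \<times> {0..1}"
  by (simp add: cylinder_def)

lemma equiv_Omega_rel: "equiv (topspace cylinder) Omega_rel"
  by (rule equivI)
    (auto simp: Omega_rel_def refl_on_def sym_def trans_def intro: equivclp_sym equivclp_trans)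

lemma Omega_class_one: "Omega_rel `` {(\<eta>, 1)} = Omega_rel `` {(tau \<eta>, 0)}"
  by (rule equiv_class_eq[OF equiv_Omega_rel])
    (auto simp: Omega_rel_def topspace_cylinder intro: glue.intros)

lemma equivclp_glue_Nstar:
  "equivclp glue p q \<Longrightarrow> fst p \<in> Nstar \<longleftrightarrow> fst q \<in> Nstar"
  by (induction rule: equivclp_induct) (auto elim!: glue.cases simp: tau_in_Nstar_iff)

text \<open>Free pairs form a union of gluing classes, because \<open>tau\<close> preserves and
  reflects freeness. This saturation allows the quotient map to be restricted.\<close>

lemma Omega_star_preimage:
  "{p \<in> topspace cylinder. Omega_rel `` {p} \<in> Omega_star} = Nstar \<times> {0..1}"
proof safe
  fix \<eta> t assume p: "(\<eta>, t) \<in> topspace cylinder" and "Omega_rel `` {(\<eta>, t)} \<in> Omega_star"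
  then obtain \<eta>' t' where "\<eta>' \<in> Nstar" "Omega_rel `` {(\<eta>, t)} = Omega_rel `` {(\<eta>', t')}"
    by (auto simp: Omega_star_def)
  moreover have "(\<eta>, t) \<in> Omega_rel `` {(\<eta>, t)}"
    using p by (simp add: Omega_rel_def)
  ultimately show "\<eta> \<in> Nstar"
    using equivclp_glue_Nstar[of "(\<eta>', t')" "(\<eta>, t)"] by (auto simp: Omega_rel_def)
qed (auto simp: topspace_cylinder Omega_star_def)

text \<open>Trading \<open>(\<eta>, 1)\<close> for \<open>(tau \<eta>, 0)\<close> brings
  \<open>t\<close> into the half-open interval, where \<open>phi_point_inj\<close> applies.\<close>

lemma Omega_star_representative:
  assumes "\<omega> \<in> Omega_star"
  obtains \<eta> t where "\<eta> \<in> Nstar" "t \<in> {0..<1}" "\<omega> = Omega_rel `` {(\<eta>, t)}"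
proof -
  obtain \<eta> t where *: "\<eta> \<in> Nstar" "t \<in> {0..1}" "\<omega> = Omega_rel `` {(\<eta>, t)}"
    using assms by (auto simp: Omega_star_def)
  show thesis
  proof (cases "t = 1")
    case True
    with * that[of "tau \<eta>" 0] show ?thesis
      by (simp add: Omega_class_one tau_in_Nstar_iff)
  next
    case False
    with * that[of \<eta> t] show ?thesis
      by simp
  qed
qed

lemma inj_on_phi: "inj_on phi Omega_star"
proof (rule inj_onI)
  fix \<omega> \<omega>' assume "\<omega> \<in> Omega_star" "\<omega>' \<in> Omega_star" and eq: "phi \<omega> = phi \<omega>'"
  from this(1) obtain \<eta> t where 1: "\<eta> \<in> Nstar" "t \<in> {0..<1}" "\<omega> = Omega_rel `` {(\<eta>, t)}"
    by (rule Omega_star_representative)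
  from \<open>\<omega>' \<in> Omega_star\<close> obtain \<eta>' t'
    where 2: "\<eta>' \<in> Nstar" "t' \<in> {0..<1}" "\<omega>' = Omega_rel `` {(\<eta>', t')}"
    by (rule Omega_star_representative)
  have "phi_point \<eta> t = phi_point \<eta>' t'"
    using eq 1 2 by (simp add: phi_class)
  from phi_point_inj[OF 1(1) 2(1) 1(2) 2(2) this] show "\<omega> = \<omega>'"
    by (simp add: 1 2)
qed

lemma phi_image: "phi ` Omega_star = C_tilde"
proof
  show "phi ` Omega_star \<subseteq> C_tilde"
    by (auto simp: Omega_star_def phi_class phi_point_in_C_tilde)
  show "C_tilde \<subseteq> phi ` Omega_star"
  proof
    fix \<psi> assume "\<psi> \<in> C_tilde"
    then obtain \<eta> t where *: "\<eta> \<in> Nstar" "t \<in> {0..1}" "\<psi> = phi_point \<eta> t"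
      using phi_ultra_eq_phi_point unfolding C_tilde_def by blast
    then have "\<psi> = phi (Omega_rel `` {(\<eta>, t)})"
      by (simp add: phi_class)
    moreover have "Omega_rel `` {(\<eta>, t)} \<in> Omega_star"
      using * by (auto simp: Omega_star_def)
    ultimately show "\<psi> \<in> phi ` Omega_star"
      by (rule image_eqI)
  qed
qed

text \<open>A quotient map restricts to a quotient map over a closed set; \<open>Omega_star\<close>
  is closed because its preimage is.\<close>

lemma quotient_map_Omega_star:
  "quotient_map (top_of_set (Nstar \<times> {0..1})) (subtopology Omega_topology Omega_star) (\<lambda>p. Omega_rel `` {p})"
proof -
  have q: "quotient_map cylinder Omega_topology (\<lambda>p. Omega_rel `` {p})"
    unfolding Omega_topology_def by (rule quotient_map_quotient_topology)
  have sub: "Omega_star \<subseteq> topspace Omega_topology"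
    unfolding quotient_imp_surjective_map[OF q, symmetric]
    by (auto simp: Omega_star_def topspace_cylinder)
  have "closedin cylinder (Nstar \<times> {0..1})"
    unfolding cylinder_def by (intro closed_subset closed_Times closed_Nstar) auto
  then have "closedin Omega_topology Omega_star"
    using q[unfolded quotient_map_closedin, THEN conjunct2, rule_format, OF sub]
    by (simp only: Omega_star_preimage)
  then have "quotient_map (subtopology cylinder (Nstar \<times> {0..1}))
      (subtopology Omega_topology Omega_star) (\<lambda>p. Omega_rel `` {p})"
    using quotient_map_restriction[OF q Omega_star_preimage] by simp
  then show ?thesis
    by (simp add: cylinder_def subtopology_subtopology Int_absorb1 Sigma_mono)
qed

lemma compact_space_Omega_star: "compact_space (subtopology Omega_topology Omega_star)"
proof -
  have "compact (Nstar \<inter> UNIV)"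
    by (intro closed_Int_compact closed_Nstar compact_UNIV_betaN)
  then have "compact_space (top_of_set (Nstar \<times> {0..1::real}))"
    by (simp add: compact_space_subtopology compactin_euclidean_iff compact_Times)
  from image_compactin[OF this[unfolded compact_space_def]
      quotient_imp_continuous_map[OF quotient_map_Omega_star]]
  show ?thesis
    unfolding compact_space_def quotient_imp_surjective_map[OF quotient_map_Omega_star] .
qed

section \<open>Weak* continuity and the homeomorphism\<close>

text \<open>By the quotient property continuity is checked on pairs, and in the weak* topology
  separately for each \<open>f\<close>.\<close>

lemma continuous_map_phi:
  "continuous_map (subtopology Omega_topology Omega_star) weak_star phi"
proof (rule continuous_compose_quotient_map[OF quotient_map_Omega_star])
  have "continuous_map (top_of_set (Nstar \<times> {0..1})) weak_star (\<lambda>p. phi_point (fst p) (snd p))"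
    by (simp add: continuous_on_strong_operator_topo_iff_coordinatewise continuous_on_phi_point)
  then show "continuous_map (top_of_set (Nstar \<times> {0..1})) weak_star (phi \<circ> (\<lambda>p. Omega_rel `` {p}))"
    by (rule continuous_map_eq) (auto simp: phi_class)
qed

text \<open>Regarding operators as functions is a continuous injection into a product of Hausdorff
  spaces.\<close>

lemma Hausdorff_space_strong_operator_topology:
  "Hausdorff_space (strong_operator_topology :: ('a::real_normed_vector \<Rightarrow>\<^sub>L 'b::real_normed_vector) topology)"
proof (rule Hausdorff_space_injective_preimage)
  show "Hausdorff_space (euclidean :: ('a \<Rightarrow> 'b) topology)"
    by (simp add: Hausdorff_space_product_topology flip: euclidean_product_topology)
  show "continuous_map strong_operator_topology euclidean
      (blinfun_apply :: ('a \<Rightarrow>\<^sub>L 'b) \<Rightarrow> 'a \<Rightarrow> 'b)"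
    unfolding strong_operator_topology_def
    using continuous_map_pullback[OF continuous_map_id, where f = blinfun_apply and A = UNIV] by (simp add: o_def)
qed (auto simp: inj_on_def blinfun_apply_inject)

theorem theorem3p1:
  shows "(\<forall>\<psi>\<in>C_tilde. \<exists>!\<omega>. \<omega> \<in> Omega_star \<and> \<psi> = phi \<omega>) \<and>
    homeomorphic_map (subtopology Omega_topology Omega_star) (subtopology weak_star C_tilde) phi"
proof
  show "\<forall>\<psi>\<in>C_tilde. \<exists>!\<omega>. \<omega> \<in> Omega_star \<and> \<psi> = phi \<omega>"
    using inj_on_phi unfolding phi_image[symmetric] by (auto dest: inj_onD)
  have topspace: "topspace (subtopology Omega_topology Omega_star) = Omega_star"
    unfolding quotient_imp_surjective_map[OF quotient_map_Omega_star, symmetric]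
    by (fastforce simp: Omega_star_def)
  show "homeomorphic_map (subtopology Omega_topology Omega_star) (subtopology weak_star C_tilde) phi"
  \<comment> \<open>A continuous bijection from a compact space onto a Hausdorff space is a
    homeomorphism.\<close>
  proof (rule continuous_imp_homeomorphic_map)
    show "continuous_map (subtopology Omega_topology Omega_star) (subtopology weak_star C_tilde) phi"
      using continuous_map_phi phi_image topspace by (auto simp: continuous_map_in_subtopology)
    show "Hausdorff_space (subtopology weak_star C_tilde)"
      by (rule Hausdorff_space_subtopology[OF Hausdorff_space_strong_operator_topology])
  qed (use topspace phi_image inj_on_phi compact_space_Omega_star in
      \<open>simp_all add: strong_operator_topology_topspace\<close>)
qed

end
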